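(* Let $n>2$ and $2\le k\le n$, and let $\mathcal{H}$ be a $k$-uniform hypergraph with $n$ vertices. Then its Seidel energy satisfies $$\mathcal{E}(\mathcal{S}(\mathcal{H}))\le n\sqrt{n-1}\left(2\binom{n-2}{k-2}-1\right).$$
   Context: A hypergraph $\mathcal{H}=(V,E)$ consists of a finite vertex set $V$ with $|V|=n$ (identified with $\{1,\dots,n\}$) and a set $E\subseteq 2^{V}$ of hyperedges. All hypergraphs are finite and simple: there is no hyperedge of size $1$, and for distinct hyperedges $e,e'$ neither $e\subset e'$ nor $e'\subset e$. $\mathcal{H}$ is $k$-uniform if every hyperedge has exactly $k$ elements. For distinct vertices $i,j$, the co-degree is $c_{ij}=|\{e\in E: i,j\in e\}|$. The Seidel matrix $\mathcal{S}(\mathcal{H})$ is the real symmetric $n\times n$ matrix with $\mathcal{S}(\mathcal{H})_{ii}=0$ and $\mathcal{S}(\mathcal{H})_{ij}=1-2c_{ij}$ for $i\ne j$. If $\rho_1,\dots,\rho_n$ are its eigenvalues (with multiplicity), the Seidel energy is $\mathcal{E}(\mathcal{S}(\mathcal{H}))=\sum_{i=1}^n|\rho_i|$. *)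

theory Defs
  imports Jordan_Normal_Form.Char_Poly "HOL-Computational_Algebra.Polynomial" Complex_Main
begin

definition hypergraph :: "'a set \<Rightarrow> 'a set set \<Rightarrow> bool" where
  "hypergraph V E \<longleftrightarrow> finite V \<and> E \<subseteq> Pow V \<and> (\<forall>e\<in>E. card e \<noteq> 1) \<and>
     (\<forall>e\<in>E. \<forall>e'\<in>E. e \<noteq> e' \<longrightarrow> \<not> e \<subset> e' \<and> \<not> e' \<subset> e)"

definition uniform :: "nat \<Rightarrow> 'a set set \<Rightarrow> bool" where
  "uniform k E \<longleftrightarrow> (\<forall>e\<in>E. card e = k)"

definition codegree :: "'a set set \<Rightarrow> 'a \<Rightarrow> 'a \<Rightarrow> nat" where
  "codegree E x y = card {e \<in> E. x \<in> e \<and> y \<in> e}"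

text \<open>The enumeration \<open>v\<close> of the \<open>n\<close> vertices, indexed from \<open>0\<close> as matrices are, is the
  identification of the vertex set with an initial segment of the naturals.\<close>

definition seidel_matrix :: "nat \<Rightarrow> (nat \<Rightarrow> 'a) \<Rightarrow> 'a set set \<Rightarrow> real mat" where
  "seidel_matrix n v E =
     mat n n (\<lambda>(i, j). if i = j then 0 else 1 - 2 * real (codegree E (v i) (v j)))"

text \<open>Eigenvalues are taken in \<open>complex\<close>, so that the multiset \<open>eigenvalues_mset A\<close> has
  exactly \<open>n\<close> elements for every \<open>n \<times> n\<close> matrix \<open>A\<close>, each counted with algebraic multiplicity.
  For symmetric \<open>A\<close> they are all real, and \<open>cmod\<close> is the absolute value.\<close>

definition eigenvalues_mset :: "real mat \<Rightarrow> complex multiset" where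
  "eigenvalues_mset A = proots (char_poly (map_mat complex_of_real A))"

definition seidel_energy :: "nat \<Rightarrow> (nat \<Rightarrow> 'a) \<Rightarrow> 'a set set \<Rightarrow> real" where
  "seidel_energy n v E = (\<Sum>\<rho>\<in>#eigenvalues_mset (seidel_matrix n v E). cmod \<rho>)"

end

(* Let c = binom(n-2, k-2) >= 1. Every codegree is at most c, so every off-diagonal entry of the
   Seidel matrix S has absolute value at most 2c - 1. As S is symmetric its eigenvalues are real,
   and the sum of their squares is tr(S^2), the sum of the squared entries, hence at most n K^2
   for K = (2c - 1) sqrt(n - 1). Summing |rho| <= (rho^2 / K + K) / 2 over the n eigenvalues
   gives the bound n K. *)

theory Submission
  imports Defs Jordan_Normal_Form.Schur_Decomposition
begin

definition mat_trace :: "'a :: comm_monoid_add mat \<Rightarrow> 'a" where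
  "mat_trace A = (\<Sum>i<dim_row A. A $$ (i, i))"

lemma mat_trace_mult:
  assumes "A \<in> carrier_mat n m" and "B \<in> carrier_mat m n"
  shows "mat_trace (A * B) = (\<Sum>i<n. \<Sum>j<m. A $$ (i, j) * B $$ (j, i))"
  using assms by (auto simp: mat_trace_def scalar_prod_def atLeast0LessThan intro!: sum.cong)

lemma mat_trace_mult_commute:
  fixes A B :: "'a :: comm_semiring_0 mat"
  assumes "A \<in> carrier_mat n m" and "B \<in> carrier_mat m n"
  shows "mat_trace (A * B) = mat_trace (B * A)"
  unfolding mat_trace_mult[OF assms] mat_trace_mult[OF assms(2,1)]
  by (subst sum.swap) (simp add: mult.commute)

text \<open>The witness gives \<open>A = P * B * Q\<close> with \<open>Q * P\<close> the identity,
  so moving \<open>Q\<close> cyclically to the front under the trace cancels it against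
  \<open>P\<close>.\<close>

lemma mat_trace_similar:
  fixes A B :: "'a :: comm_ring_1 mat"
  assumes "similar_mat_wit A B P Q"
  shows "mat_trace A = mat_trace B"
proof -
  note wit = similar_mat_witD[OF refl assms]
  define n where "n = dim_row A"
  note wit = wit[folded n_def]
  have "mat_trace A = mat_trace (Q * (P * B))"
    unfolding wit(3) using wit by (intro mat_trace_mult_commute[of _ n n]) auto
  also have "Q * (P * B) = B"
    using wit(2,5-7) by (simp flip: assoc_mult_mat[of Q n n P n B n])
  finally show ?thesis .
qed

text \<open>For \<open>j \<noteq> i\<close> one of the positions \<open>(i, j)\<close> and
  \<open>(j, i)\<close> lies strictly below the diagonal, so only the summand with
  \<open>j = i\<close> survives.\<close>

lemma upper_triangular_mult_diag:
  fixes B :: "'a :: semiring_0 mat"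
  assumes B: "B \<in> carrier_mat n n" and "upper_triangular B" and i: "i < n"
  shows "(B * B) $$ (i, i) = B $$ (i, i) * B $$ (i, i)"
proof -
  have "B $$ (i, j) * B $$ (j, i) = 0" if "j < n" "j \<noteq> i" for j
    using that assms upper_triangularD[of B] by (cases "j < i") auto
  then have "(\<Sum>j<n. B $$ (i, j) * B $$ (j, i)) =
      (\<Sum>j<n. if j = i then B $$ (i, i) * B $$ (i, i) else 0)"
    by (intro sum.cong) auto
  then show ?thesis
    using B i by (simp add: scalar_prod_def atLeast0LessThan)
qed

text \<open>Schur decomposition makes \<open>A\<close> similar to an upper triangular
  \<open>B\<close> with diagonal \<open>as\<close>. Then \<open>A * A\<close> and
  \<open>B * B\<close> are similar, so they share their trace, and the diagonal of
  \<open>B * B\<close> consists of the squares of the entries of \<open>as\<close>.\<close>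

lemma sum_list_eigenvalues_sq:
  fixes A :: "'a :: conjugatable_ordered_field mat"
  assumes A: "A \<in> carrier_mat n n" and cp: "char_poly A = (\<Prod>a\<leftarrow>as. [:- a, 1:])"
  shows "(\<Sum>a\<leftarrow>as. a * a) = mat_trace (A * A)"
proof -
  obtain B P Q where "schur_decomposition A as = (B, P, Q)"
    by (metis prod_cases3)
  from schur_decomposition[OF A cp this]
  have wit: "similar_mat_wit A B P Q" and ut: "upper_triangular B" and diag: "diag_mat B = as"
    by auto
  note w = similar_mat_witD2[OF A wit]
  have sq: "M ^\<^sub>m 2 = M * M" if "M \<in> carrier_mat n n" for M :: "'a mat"
    using that by (simp add: numeral_2_eq_2)
  have "mat_trace (A * A) = mat_trace (B * B)"
    using mat_trace_similar[OF similar_mat_wit_pow[OF wit, of 2]] sq A w by simp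
  also have "\<dots> = (\<Sum>i<n. B $$ (i, i) * B $$ (i, i))"
    using w(5) upper_triangular_mult_diag[OF w(5) ut] by (simp add: mat_trace_def)
  also have "\<dots> = (\<Sum>a\<leftarrow>diag_mat B. a * a)"
    using w(5) by (simp add: diag_mat_def interv_sum_list_conv_sum_set_nat atLeast0LessThan o_def)
  finally show ?thesis using diag by simp
qed

text \<open>The Hermitian argument: \<open>A\<close> is real and symmetric, so moving it across the
  inner product of an eigenvector \<open>x\<close> with itself replaces \<rho> by its
  conjugate.\<close>

lemma eigenvalue_symmetric_real:
  fixes S :: "real mat"
  defines "A \<equiv> map_mat complex_of_real S"
  assumes S: "S \<in> carrier_mat n n" and sym: "transpose_mat S = S" and ev: "eigenvalue A \<rho>"
  shows "\<rho> \<in> \<real>"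
proof -
  have A: "A \<in> carrier_mat n n" and symA: "transpose_mat A = A"
    using S sym by (auto simp: A_def map_mat_transpose)
  obtain x where x: "x \<in> carrier_vec n" "x \<noteq> 0\<^sub>v n" and Ax: "A *\<^sub>v x = \<rho> \<cdot>\<^sub>v x"
    using ev A by (auto simp: eigenvalue_def eigenvector_def)
  have "A *\<^sub>v conjugate x = conjugate (A *\<^sub>v x)"
    using S x by (intro eq_vecI) (auto simp: A_def scalar_prod_def)
  then have Ac: "A *\<^sub>v conjugate x = cnj \<rho> \<cdot>\<^sub>v conjugate x"
    by (simp add: Ax conjugate_smult_vec)
  have "\<rho> * (x \<bullet>c x) = (transpose_mat A *\<^sub>v x) \<bullet>c x"
    using x by (simp add: Ax symA)
  also have "\<dots> = x \<bullet> (A *\<^sub>v conjugate x)"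
    using A x by (intro transpose_vec_mult_scalar) auto
  also have "\<dots> = cnj \<rho> * (x \<bullet>c x)"
    using x by (simp add: Ac)
  \<comment> \<open>The factor \<open>x \<bullet>c x\<close> cancels, being nonzero for
    \<open>x \<noteq> 0\<^sub>v n\<close>.\<close>
  finally have "\<rho> = cnj \<rho>"
    using x by simp
  then show ?thesis
    by (simp add: Reals_cnj_iff)
qed

lemma proots_prod_linear:
  fixes as :: "'a :: idom list"
  shows "proots (\<Prod>a\<leftarrow>as. [:- a, 1:]) = mset as"
proof (induction as)
  case (Cons a as)
  have "(\<Prod>a\<leftarrow>as. [:- a, 1:]) \<noteq> 0"
    by auto
  with Cons show ?case
    \<comment> \<open>Expanding the product with the linear factor would hide the shape that
      \<open>proots_mult\<close> needs.\<close>
    by (simp add: proots_mult del: mult_pCons_left)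
qed simp

lemma sum_eigenvalues_cmod_sq:
  assumes S: "S \<in> carrier_mat n n" and sym: "transpose_mat S = S"
  shows "(\<Sum>\<rho>\<in>#eigenvalues_mset S. (cmod \<rho>)\<^sup>2) = (\<Sum>i<n. \<Sum>j<n. (S $$ (i, j))\<^sup>2)"
    and "size (eigenvalues_mset S) = n"
proof -
  define A where "A = map_mat complex_of_real S"
  have A: "A \<in> carrier_mat n n"
    using S by (simp add: A_def)
  obtain as where cp: "char_poly A = (\<Prod>a\<leftarrow>as. [:- a, 1:])" and len: "length as = n"
    using char_poly_factorized[OF A] by blast
  have mset: "eigenvalues_mset S = mset as"
    by (simp add: eigenvalues_mset_def cp proots_prod_linear flip: A_def)
  then show "size (eigenvalues_mset S) = n"
    by (simp add: len)
  \<comment> \<open>The trace yields the squares \<open>a * a\<close>, not squared moduli; the two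
    agree because the eigenvalues are real.\<close>
  have real: "complex_of_real ((cmod a)\<^sup>2) = a * a" if "a \<in> set as" for a
  proof -
    have "poly (char_poly A) a = 0"
      using that linear_poly_root[of a as] by (simp add: cp)
    then have "a \<in> \<real>"
      using eigenvalue_symmetric_real[OF S sym] eigenvalue_root_char_poly[OF A] A_def by auto
    then show ?thesis
      by (auto elim!: Reals_cases simp: power2_eq_square simp flip: of_real_mult)
  qed
  have "complex_of_real (\<Sum>a\<leftarrow>as. (cmod a)\<^sup>2) = (\<Sum>a\<leftarrow>as. complex_of_real ((cmod a)\<^sup>2))"
    by (induction as) auto
  also have "\<dots> = (\<Sum>a\<leftarrow>as. a * a)"
    using real by (intro arg_cong[of _ _ sum_list] map_cong) auto
  also have "\<dots> = mat_trace (A * A)"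
    by (rule sum_list_eigenvalues_sq[OF A cp])
  also have "\<dots> = (\<Sum>i<n. \<Sum>j<n. complex_of_real ((S $$ (i, j))\<^sup>2))"
  proof -
    \<comment> \<open>Symmetry turns the products of opposite entries in the trace into
      squares.\<close>
    have "S $$ (j, i) = S $$ (i, j)" if "i < n" "j < n" for i j
      using sym S that by (metis carrier_matD index_transpose_mat(1))
    then show ?thesis
      unfolding mat_trace_mult[OF A A] using S
      by (intro sum.cong) (auto simp: A_def power2_eq_square)
  qed
  also have "\<dots> = complex_of_real (\<Sum>i<n. \<Sum>j<n. (S $$ (i, j))\<^sup>2)"
    by simp
  finally have "(\<Sum>a\<leftarrow>as. (cmod a)\<^sup>2) = (\<Sum>i<n. \<Sum>j<n. (S $$ (i, j))\<^sup>2)"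
    by (rule of_real_eq_iff[THEN iffD1])
  then show "(\<Sum>\<rho>\<in>#eigenvalues_mset S. (cmod \<rho>)\<^sup>2) = (\<Sum>i<n. \<Sum>j<n. (S $$ (i, j))\<^sup>2)"
    by (simp add: mset sum_mset_sum_list flip: mset_map)
qed

text \<open>Deleting \<open>x\<close> and \<open>y\<close> maps the edges through both injectively
  to \<open>(k - 2)\<close>-subsets of the other \<open>card V - 2\<close> vertices.\<close>

lemma codegree_le:
  assumes V: "finite V" "E \<subseteq> Pow V" and unif: "uniform k E"
    and xy: "x \<in> V" "y \<in> V" "x \<noteq> y"
  shows "codegree E x y \<le> (card V - 2) choose (k - 2)"
proof -
  let ?F = "{e \<in> E. x \<in> e \<and> y \<in> e}"
  let ?G = "{B. B \<subseteq> V - {x, y} \<and> card B = k - 2}"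
  have "inj_on (\<lambda>e. e - {x, y}) ?F"
    by (intro inj_onI) blast
  moreover have "(\<lambda>e. e - {x, y}) ` ?F \<subseteq> ?G"
  proof clarify
    fix e assume e: "e \<in> E" "x \<in> e" "y \<in> e"
    then have "finite e" "card e = k"
      using V unif finite_subset[of e V] by (auto simp: uniform_def)
    then show "e - {x, y} \<subseteq> V - {x, y} \<and> card (e - {x, y}) = k - 2"
      using e V xy by (auto simp: card_Diff_subset)
  qed
  ultimately have "card ?F \<le> card ?G"
    using V by (intro card_inj_on_le) auto
  also have "\<dots> = (card V - 2) choose (k - 2)"
    using V xy by (simp add: n_subsets card_Diff_subset numeral_2_eq_2)
  finally show ?thesis
    by (simp add: codegree_def)
qed

text \<open>This is the inequality between arithmetic and quadratic mean. It is proved with both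
  sides scaled by \<open>2 * K\<close>, which avoids division and is undone at the end by
  \<open>K > 0\<close>.\<close>

lemma sum_mset_cmod_le:
  fixes K :: real
  assumes "K > 0" and sq: "(\<Sum>\<rho>\<in>#M. (cmod \<rho>)\<^sup>2) \<le> real (size M) * K\<^sup>2"
  shows "(\<Sum>\<rho>\<in>#M. cmod \<rho>) \<le> real (size M) * K"
proof -
  have "2 * K * (\<Sum>\<rho>\<in>#M. cmod \<rho>) \<le> (\<Sum>\<rho>\<in>#M. (cmod \<rho>)\<^sup>2) + real (size M) * K\<^sup>2"
  proof (induction M)
    case (add \<rho> M)
    have "2 * K * cmod \<rho> \<le> (cmod \<rho>)\<^sup>2 + K\<^sup>2"
      using sum_squares_bound[of K "cmod \<rho>"] by simp
    with add show ?case
      by (simp add: algebra_simps)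
  qed simp
  also have "\<dots> \<le> 2 * K * (real (size M) * K)"
    using sq by (simp add: power2_eq_square algebra_simps)
  finally show ?thesis
    by (rule mult_left_le_imp_le) (use \<open>K > 0\<close> in simp)
qed

theorem theorem3p9:
  fixes V :: "'a set" and E :: "'a set set" and n k :: nat and v :: "nat \<Rightarrow> 'a"
  assumes "hypergraph V E" and "card V = n" and "bij_betw v {0..<n} V"
    and "n > 2" and "2 \<le> k" and "k \<le> n" and "uniform k E"
  shows "seidel_energy n v E \<le>
    real n * sqrt (real n - 1) * (2 * real ((n - 2) choose (k - 2)) - 1)"
proof -
  define c where "c = real ((n - 2) choose (k - 2))"
  define S where "S = seidel_matrix n v E"
  define K where "K = sqrt (real n - 1) * (2 * c - 1)"
  \<comment> \<open>Nonzero because \<open>k - 2 \<le> n - 2\<close>; the resulting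
    \<open>c \<ge> 1\<close> makes \<open>2 * c - 1\<close>, and with it \<open>K\<close>,
    positive.\<close>
  have "(n - 2) choose (k - 2) \<noteq> 0"
    using assms by simp
  then have c: "c \<ge> 1"
    unfolding c_def by linarith
  have S: "S \<in> carrier_mat n n"
    by (simp add: S_def seidel_matrix_def)
  have entry: "S $$ (i, j) = (if i = j then 0 else 1 - 2 * real (codegree E (v i) (v j)))"
    if "i < n" "j < n" for i j
    using that by (simp add: S_def seidel_matrix_def)
  have sym: "transpose_mat S = S"
    using S entry by (intro eq_matI) (auto simp: codegree_def conj_commute)
  have le: "(S $$ (i, j))\<^sup>2 \<le> (if i = j then 0 else (2 * c - 1)\<^sup>2)" if ij: "i < n" "j < n" for i j
  proof (cases "i = j")
    case False
    have "v i \<in> V" "v j \<in> V" "v i \<noteq> v j"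
      using assms(3) ij False by (auto simp: bij_betw_def inj_on_def)
    then have "codegree E (v i) (v j) \<le> (n - 2) choose (k - 2)"
      using codegree_le[of V E k "v i" "v j"] assms(1,2,7) by (auto simp: hypergraph_def)
    then have "real (codegree E (v i) (v j)) \<le> c"
      by (simp add: c_def)
    \<comment> \<open>The entry lies between \<open>1 - 2 * c\<close> and \<open>1\<close>, and
      \<open>1 \<le> 2 * c - 1\<close>.\<close>
    then have "\<bar>S $$ (i, j)\<bar> \<le> \<bar>2 * c - 1\<bar>"
      using c ij False by (simp add: entry abs_if)
    then show ?thesis
      using False by (simp add: abs_le_square_iff)
  qed (use ij in \<open>simp add: entry\<close>)
  \<comment> \<open>The zero diagonal leaves \<open>n - 1\<close> terms per row, whence the factor
    \<open>sqrt (real n - 1)\<close> in \<open>K\<close>.\<close>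
  have row: "(\<Sum>j<n. if i = j then 0 else (2 * c - 1)\<^sup>2) = K\<^sup>2" if "i < n" for i
  proof -
    have "(\<Sum>j<n. if i = j then 0 else (2 * c - 1)\<^sup>2) = (\<Sum>j\<in>{..<n} - {i}. (2 * c - 1)\<^sup>2)"
      by (intro sum.mono_neutral_cong_right) auto
    also have "\<dots> = K\<^sup>2"
      using that assms(4) by (simp add: K_def power_mult_distrib of_nat_diff)
    finally show ?thesis .
  qed
  have "(\<Sum>\<rho>\<in>#eigenvalues_mset S. (cmod \<rho>)\<^sup>2) = (\<Sum>i<n. \<Sum>j<n. (S $$ (i, j))\<^sup>2)"
    by (rule sum_eigenvalues_cmod_sq[OF S sym])
  also have "\<dots> \<le> (\<Sum>i<n. \<Sum>j<n. if i = j then 0 else (2 * c - 1)\<^sup>2)"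
    using le by (intro sum_mono) auto
  also have "\<dots> = real n * K\<^sup>2"
    using row by simp
  finally have "(\<Sum>\<rho>\<in>#eigenvalues_mset S. cmod \<rho>) \<le> real n * K"
    using sum_mset_cmod_le[of K "eigenvalues_mset S"] sum_eigenvalues_cmod_sq(2)[OF S sym] c assms(4)
    by (simp add: K_def)
  then show ?thesis
    by (simp add: seidel_energy_def S_def K_def c_def mult.assoc)
qed

end
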